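(* Let $f\in\Lambda$, and write $f[X_{\mathbf N}]$ as a sum of monomials $f[X_{\mathbf N}]=\sum_{\alpha\in\mathcal C}c_\alpha X^\alpha$. Then $$ f s_\beta=\sum_{\alpha\in\mathcal C}c_\alpha\, s_{\alpha+\beta}\qquad\text{for all }\beta\in\mathcal C. $$
   Context: $\mathbf N=\{0,1,2,\ldots\}$. A composition is a finitely supported sequence $\alpha=(\alpha_i)_{i\in\mathbf N}$ of natural numbers; $\mathcal C$ is the set of all compositions; they are added entrywise. Finite vectors are identified with their extension by zeros, so $\mathbf N^n\subset\mathcal C$ consists of the $\alpha$ with $\alpha_i=0$ for $i\ge n$. $X^\alpha=\prod_{i\in\mathbf N}X_i^{\alpha_i}$. $\Lambda$ is the ring of symmetric functions over $\mathbf Z$, realised as the ring of power series over $\mathbf Z$ in commuting indeterminates $X_i$ ($i\in\mathbf N$), of bounded degree, that are invariant under permutations of the indeterminates; $f[X_{\mathbf N}]$ denotes $f\in\Lambda$ in this realisation, and $f[X_{[n]}]\in\mathbf Z[X_0,\ldots,X_{n-1}]$ the symmetric polynomial obtained from it by setting $X_i=0$ for all $i\ge n$. For $\alpha\in\mathbf N^n$ put $a_\alpha[X_{[n]}]=\sum_{\sigma\in\mathbf S_n}\operatorname{sgn}(\sigma)\prod_{i=0}^{n-1}X_{\sigma(i)}^{\alpha_i}$, and let $\delta_n=(n-1,n-2,\ldots,1,0)$. For $\alpha\in\mathbf N^n$ set $s_\alpha[X_{[n]}]=a_{\delta_n+\alpha}[X_{[n]}]/a_{\delta_n}[X_{[n]}]$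 (a symmetric polynomial), and for $\alpha\in\mathcal C\setminus\mathbf N^n$ set $s_\alpha[X_{[n]}]=0$. For every composition $\alpha\in\mathcal C$ (not necessarily a partition), $s_\alpha\in\Lambda$ is the unique symmetric function whose image in $\mathbf Z[X_0,\ldots,X_{n-1}]$ is $s_\alpha[X_{[n]}]$ for all $n\in\mathbf N$. An infinite sum in $\Lambda$ is understood as a sum having only finitely many nonzero terms. *)

theory Defs
  imports "HOL-Library.Poly_Mapping" "HOL-Combinatorics.Permutations"
begin

type_synonym composition = "nat \<Rightarrow>\<^sub>0 nat"

type_synonym int_mpoly = "composition \<Rightarrow>\<^sub>0 int"

definition vectors :: "nat \<Rightarrow> composition set" where
  "vectors n = {\<alpha>. Poly_Mapping.keys \<alpha> \<subseteq> {..<n}}"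

definition weight :: "composition \<Rightarrow> nat" where
  "weight \<alpha> = (\<Sum>i\<in>Poly_Mapping.keys \<alpha>. Poly_Mapping.lookup \<alpha> i)"

text \<open>
  The ring of all formal power series over the integers in the indeterminates
  \<open>X 0, X 1, \<dots>\<close>. A series is given by its family of coefficients, so \<open>coeff f \<alpha>\<close>
  is the coefficient of \<open>X^\<alpha>\<close> in \<open>f\<close>.
\<close>

typedef pseries = "UNIV :: (composition \<Rightarrow> int) set"
  morphisms coeff Pseries
  by simp

setup_lifting type_definition_pseries

lemma pseries_eqI: "(\<And>\<alpha>. coeff f \<alpha> = coeff g \<alpha>) \<Longrightarrow> f = g"
  by (simp add: coeff_inject[symmetric] fun_eq_iff)

definition splits :: "composition \<Rightarrow> (composition \<times> composition) set" where
  "splits \<alpha> = {(\<beta>, \<gamma>). \<beta> + \<gamma> = \<alpha>}"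

lemma finite_bounded_compositions:
  fixes A :: "nat set"
  assumes "finite A"
  shows "finite {\<alpha> :: composition. Poly_Mapping.keys \<alpha> \<subseteq> A \<and>
           (\<forall>i. Poly_Mapping.lookup \<alpha> i \<le> m)}" (is "finite ?S")
proof -
  have "Poly_Mapping.lookup ` ?S \<subseteq> {f. \<forall>i. (i \<in> A \<longrightarrow> f i \<in> {..m}) \<and> (i \<notin> A \<longrightarrow> f i = 0)}"
    by (auto simp: in_keys_iff)
  moreover have "finite {f :: nat \<Rightarrow> nat. \<forall>i. (i \<in> A \<longrightarrow> f i \<in> {..m}) \<and> (i \<notin> A \<longrightarrow> f i = 0)}"
    using finite_set_of_finite_funs[OF assms, of "{..m}" 0] by simp
  ultimately have "finite (Poly_Mapping.lookup ` ?S)"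
    by (rule finite_subset)
  moreover have "inj_on Poly_Mapping.lookup ?S"
    by (auto simp: inj_on_def intro: poly_mapping_eqI)
  ultimately show ?thesis
    by (rule finite_imageD)
qed

lemma finite_splits [simp]: "finite (splits \<alpha>)"
proof -
  define m where "m = weight \<alpha>"
  define S where "S = {\<beta> :: composition. Poly_Mapping.keys \<beta> \<subseteq> Poly_Mapping.keys \<alpha> \<and>
           (\<forall>i. Poly_Mapping.lookup \<beta> i \<le> m)}"
  have bound: "Poly_Mapping.lookup \<alpha> i \<le> m" for i
  proof (cases "i \<in> Poly_Mapping.keys \<alpha>")
    case True
    then show ?thesis
      unfolding m_def weight_def by (intro member_le_sum) auto
  qed (simp add: in_keys_iff)
  have "\<beta> \<in> S" if "\<beta> + \<gamma> = \<alpha>" for \<beta> \<gamma>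
  proof -
    have "Poly_Mapping.lookup \<beta> i \<le> Poly_Mapping.lookup \<alpha> i" for i
      using that by (auto simp: lookup_add)
    then show ?thesis
      using bound unfolding S_def
      by (auto simp: in_keys_iff) (metis le_zero_eq not_gr_zero, meson le_trans)
  qed
  then have "splits \<alpha> \<subseteq> S \<times> S"
    unfolding splits_def by (auto; metis add.commute)
  moreover have "finite S"
    unfolding S_def by (rule finite_bounded_compositions) simp
  ultimately show ?thesis
    by (meson finite_SigmaI finite_subset)
qed

instantiation pseries :: comm_ring_1
begin

lift_definition zero_pseries :: pseries is "\<lambda>_. 0" .
lift_definition one_pseries :: pseries is "\<lambda>\<alpha>. if \<alpha> = 0 then 1 else 0" .
lift_definition plus_pseries :: "pseries \<Rightarrow> pseries \<Rightarrow> pseries" is "\<lambda>f g \<alpha>. f \<alpha> + g \<alpha>" .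
lift_definition minus_pseries :: "pseries \<Rightarrow> pseries \<Rightarrow> pseries" is "\<lambda>f g \<alpha>. f \<alpha> - g \<alpha>" .
lift_definition uminus_pseries :: "pseries \<Rightarrow> pseries" is "\<lambda>f \<alpha>. - f \<alpha>" .
lift_definition times_pseries :: "pseries \<Rightarrow> pseries \<Rightarrow> pseries" is
  "\<lambda>f g \<alpha>. \<Sum>(\<beta>, \<gamma>)\<in>splits \<alpha>. f \<beta> * g \<gamma>" .

instance
proof
  fix a b c :: pseries
  show "a + b + c = a + (b + c)" by transfer auto
  show "a + b = b + a" by transfer auto
  show "0 + a = a" by transfer auto
  show "- a + a = 0" by transfer auto
  show "a - b = a + - b" by transfer auto
  show "(0::pseries) \<noteq> 1" by transfer (auto simp: fun_eq_iff)
  show "(a + b) * c = a * c + b * c"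
    by transfer (auto simp: fun_eq_iff algebra_simps sum.distrib split_def)
  show "a * b = b * a"
  proof (transfer, rule ext)
    fix f g :: "composition \<Rightarrow> int" and \<alpha> :: composition
    show "(\<Sum>(\<beta>, \<gamma>)\<in>splits \<alpha>. f \<beta> * g \<gamma>) = (\<Sum>(\<beta>, \<gamma>)\<in>splits \<alpha>. g \<beta> * f \<gamma>)"
      by (rule sum.reindex_bij_witness[of _ prod.swap prod.swap])
        (auto simp: splits_def add.commute mult.commute)
  qed
  show "1 * a = a"
  proof (transfer, rule ext)
    fix f :: "composition \<Rightarrow> int" and \<alpha> :: composition
    have "(\<Sum>(\<beta>, \<gamma>)\<in>splits \<alpha>. (if \<beta> = 0 then 1 else 0) * f \<gamma>)
        = (\<Sum>(\<beta>, \<gamma>)\<in>{(0 :: composition, \<alpha>)}. (if \<beta> = 0 then 1 else 0) * f \<gamma>)"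
      by (rule sum.mono_neutral_right[OF finite_splits]) (auto simp: splits_def split: if_splits)
    then show "(\<Sum>(\<beta>, \<gamma>)\<in>splits \<alpha>. (if \<beta> = 0 then 1 else 0) * f \<gamma>) = f \<alpha>"
      by simp
  qed
  show "a * b * c = a * (b * c)"
  proof (transfer, rule ext)
    fix f g h :: "composition \<Rightarrow> int" and \<alpha> :: composition
    have "(\<Sum>(\<beta>, \<gamma>)\<in>splits \<alpha>. (\<Sum>(\<mu>, \<nu>)\<in>splits \<beta>. f \<mu> * g \<nu>) * h \<gamma>)
        = (\<Sum>p\<in>splits \<alpha>. \<Sum>q\<in>splits (fst p). f (fst q) * g (snd q) * h (snd p))"
      by (simp add: split_def sum_distrib_right)
    also have "\<dots> = (\<Sum>(p, q)\<in>Sigma (splits \<alpha>) (\<lambda>p. splits (fst p)). f (fst q) * g (snd q) * h (snd p))"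
      by (rule sum.Sigma) auto
    also have "\<dots> = (\<Sum>(p, q)\<in>Sigma (splits \<alpha>) (\<lambda>p. splits (snd p)). f (fst p) * (g (fst q) * h (snd q)))"
      by (rule sum.reindex_bij_witness[of _
            "\<lambda>(p, q). ((fst p + fst q, snd q), (fst p, fst q))"
            "\<lambda>(p, q). ((fst q, snd q + snd p), (snd q, snd p))"])
        (auto simp: splits_def add.assoc mult.assoc)
    also have "\<dots> = (\<Sum>p\<in>splits \<alpha>. \<Sum>q\<in>splits (snd p). f (fst p) * (g (fst q) * h (snd q)))"
      by (rule sum.Sigma[symmetric]) auto
    also have "\<dots> = (\<Sum>(\<beta>, \<gamma>)\<in>splits \<alpha>. f \<beta> * (\<Sum>(\<mu>, \<nu>)\<in>splits \<gamma>. g \<mu> * h \<nu>))"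
      by (simp add: split_def sum_distrib_left)
    finally show "(\<Sum>(\<beta>, \<gamma>)\<in>splits \<alpha>. (\<Sum>(\<mu>, \<nu>)\<in>splits \<beta>. f \<mu> * g \<nu>) * h \<gamma>)
        = (\<Sum>(\<beta>, \<gamma>)\<in>splits \<alpha>. f \<beta> * (\<Sum>(\<mu>, \<nu>)\<in>splits \<gamma>. g \<mu> * h \<nu>))" .
  qed
qed

end

text \<open>
  \<open>Lambda\<close> is a subring of \<^typ>\<open>pseries\<close>. Permuting the indeterminates of \<open>f\<close> by a
  bijection \<open>\<pi>\<close> moves the coefficient of \<open>X^(\<alpha> \<circ> \<pi>)\<close> to that of \<open>X^\<alpha>\<close>, where
  \<^term>\<open>Poly_Mapping.map_key \<pi> \<alpha>\<close> is the composition \<open>\<alpha> \<circ> \<pi>\<close>.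
\<close>

definition Lambda :: "pseries set" where
  "Lambda = {f. (\<exists>d. \<forall>\<alpha>. coeff f \<alpha> \<noteq> 0 \<longrightarrow> weight \<alpha> \<le> d) \<and>
                (\<forall>\<pi>. bij \<pi> \<longrightarrow> (\<forall>\<alpha>. coeff f (Poly_Mapping.map_key \<pi> \<alpha>) = coeff f \<alpha>))}"

text \<open>
  The polynomial \<open>f[X\<^bsub>[n]\<^esub>]\<close>, obtained from \<open>f\<close> by setting \<open>X i = 0\<close> for all \<open>i \<ge> n\<close>.
  It is only meaningful for series of bounded degree, for which
  \<open>lookup_truncate\<close> below holds.
\<close>

definition truncate :: "nat \<Rightarrow> pseries \<Rightarrow> int_mpoly" where
  "truncate n f = Abs_poly_mapping (\<lambda>\<alpha>. if \<alpha> \<in> vectors n then coeff f \<alpha> else 0)"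

lemma lookup_truncate:
  assumes "f \<in> Lambda"
  shows "Poly_Mapping.lookup (truncate n f) \<alpha> = (if \<alpha> \<in> vectors n then coeff f \<alpha> else 0)"
proof -
  from assms obtain d where d: "\<And>\<alpha>. coeff f \<alpha> \<noteq> 0 \<Longrightarrow> weight \<alpha> \<le> d"
    unfolding Lambda_def by auto
  have "Poly_Mapping.lookup \<beta> i \<le> d" if "coeff f \<beta> \<noteq> 0" for \<beta> i
  proof (cases "i \<in> Poly_Mapping.keys \<beta>")
    case True
    then have "Poly_Mapping.lookup \<beta> i \<le> weight \<beta>"
      unfolding weight_def by (intro member_le_sum) auto
    with d[OF that] show ?thesis by simp
  qed (simp add: in_keys_iff)
  then have "{\<beta>. (if \<beta> \<in> vectors n then coeff f \<beta> else 0) \<noteq> 0} \<subseteq>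
      {\<beta>. Poly_Mapping.keys \<beta> \<subseteq> {..<n} \<and> (\<forall>i. Poly_Mapping.lookup \<beta> i \<le> d)}"
    by (auto simp: vectors_def split: if_splits)
  then have "finite {\<beta>. (if \<beta> \<in> vectors n then coeff f \<beta> else 0) \<noteq> 0}"
    by (rule finite_subset) (rule finite_bounded_compositions, simp)
  then show ?thesis
    unfolding truncate_def by (subst Abs_poly_mapping_inverse) auto
qed

definition X :: "nat \<Rightarrow> int_mpoly" where
  "X i = Poly_Mapping.single (Poly_Mapping.single i 1) 1"

definition alternant :: "nat \<Rightarrow> composition \<Rightarrow> int_mpoly" where
  "alternant n \<alpha> = (\<Sum>\<sigma> | \<sigma> permutes {..<n}.
     of_int (sign \<sigma>) * (\<Prod>i<n. X (\<sigma> i) ^ Poly_Mapping.lookup \<alpha> i))"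

definition staircase :: "nat \<Rightarrow> composition" where
  "staircase n = (\<Sum>i<n. Poly_Mapping.single i (n - 1 - i))"

text \<open>
  The type \<^typ>\<open>int_mpoly\<close> is an integral domain without a division operation; the
  quotient of alternants is the unique polynomial \<open>q\<close> with the indicated product.
\<close>

definition schur_poly :: "nat \<Rightarrow> composition \<Rightarrow> int_mpoly" where
  "schur_poly n \<alpha> =
     (if \<alpha> \<in> vectors n
      then THE q. q * alternant n (staircase n) = alternant n (staircase n + \<alpha>)
      else 0)"

definition schur :: "composition \<Rightarrow> pseries" where
  "schur \<alpha> = (THE s. s \<in> Lambda \<and> (\<forall>n. truncate n s = schur_poly n \<alpha>))"

end

theory Submission
  imports "Jordan_Normal_Form.Determinant" "HOL-Computational_Algebra.Formal_Power_Series" Defs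
begin

text \<open>
  In \<open>n\<close> indeterminates the symmetry of \<open>f\<close> gives \<open>f \<cdot> a\<^sub>\<gamma> = \<Sum>\<^sub>\<alpha> c\<^sub>\<alpha> a\<^bsub>\<gamma>+\<alpha>\<^esub>\<close>: in the summand of
  \<open>a\<^sub>\<gamma>\<close> belonging to \<open>\<sigma>\<close>, expand \<open>f\<close> in the monomials permuted by \<open>\<sigma>\<close>. Taking \<open>\<gamma> = \<delta> + \<beta>\<close> and
  cancelling \<open>a\<^sub>\<delta>\<close> proves the claim in every finite number of indeterminates.

  That \<open>s\<^sub>\<alpha>\<close> exists in \<open>\<Lambda>\<close> is shown by the Jacobi-Trudi determinant: from
  \<open>1 / (1 - X\<^sub>j t) = H(t) \<cdot> (\<Prod>i\<noteq>j. 1 - X\<^sub>i t)\<close> the matrix of powers \<open>X\<^sub>j\<close> factors as a matrix of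
  complete symmetric functions times a matrix independent of \<open>\<alpha>\<close>, whose determinant is \<open>a\<^sub>\<delta>\<close>.
\<close>

subsection \<open>The Jacobi-Trudi identity\<close>

text \<open>The determinant with entries \<open>h (\<alpha> i + j - i)\<close>, where negative
  indices give 0. The Leibniz sum over an arbitrary commutative ring serves both for power series
  and for polynomials, and truncation passes through it termwise.\<close>

definition jacobi_trudi :: "nat \<Rightarrow> (nat \<Rightarrow> 'a::comm_ring_1) \<Rightarrow> (nat \<Rightarrow> nat) \<Rightarrow> 'a" where
  "jacobi_trudi n h \<alpha> = (\<Sum>\<sigma> | \<sigma> permutes {..<n}. of_int (sign \<sigma>) *
     (\<Prod>i<n. if i \<le> \<alpha> i + \<sigma> i then h (\<alpha> i + \<sigma> i - i) else 0))"

lemma fps_nth_prod_linear_eq_0: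
  fixes x :: "'b \<Rightarrow> 'a::comm_ring_1"
  assumes "finite A" "card A < k"
  shows "fps_nth (\<Prod>i\<in>A. 1 - fps_const (x i) * fps_X) k = 0"
  using assms
proof (induction A arbitrary: k rule: finite_induct)
  case (insert a A)
  let ?P = "\<Prod>i\<in>A. 1 - fps_const (x i) * fps_X"
  have "(\<Prod>i\<in>insert a A. 1 - fps_const (x i) * fps_X) = ?P - fps_const (x a) * (fps_X * ?P)"
    using insert.hyps by (simp add: algebra_simps)
  moreover have "fps_nth ?P k = 0" "fps_nth (fps_X * ?P) k = 0"
    using insert by (auto simp del: fps_mult_fps_X_commute)
  ultimately show ?case
    by (simp del: fps_mult_fps_X_commute)
qed simp

text \<open>Multiplying the geometric series of \<open>x j\<close> by H and its inverse product
  cancels the factor for j. What is left is H times the product over the other indices, and the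
  coefficients of degree p are compared.\<close>

lemma power_eq_sum_complete:
  fixes x :: "nat \<Rightarrow> 'a::comm_ring_1"
  assumes H: "H * (\<Prod>i<n. 1 - fps_const (x i) * fps_X) = 1" and "j < n"
  shows "x j ^ p = (\<Sum>k<n. (if k \<le> p then fps_nth H (p - k) else 0) *
           fps_nth (\<Prod>i\<in>{..<n} - {j}. 1 - fps_const (x i) * fps_X) k)"
proof -
  define L where "L i = 1 - fps_const (x i) * fps_X" for i
  define Q where "Q = (\<Prod>i\<in>{..<n} - {j}. L i)"
  define G where "G = Abs_fps (\<lambda>p. x j ^ p)"
  have "fps_nth (G * L j) k = fps_nth 1 k" for k
    by (cases k) (simp_all add: G_def L_def algebra_simps)
  then have G: "G * L j = 1"
    by (simp add: fps_eq_iff)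
  have "(\<Prod>i<n. L i) = L j * Q"
    unfolding Q_def using \<open>j < n\<close> by (simp add: prod.remove)
  with H have H': "H * (L j * Q) = 1"
    by (simp add: L_def)
  have "G = G * (H * (L j * Q))"
    by (simp add: H')
  also have "\<dots> = (G * L j) * (Q * H)"
    by (simp add: algebra_simps)
  finally have "G = Q * H"
    by (simp add: G)
  then have "x j ^ p = (\<Sum>k\<le>p. fps_nth Q k * fps_nth H (p - k))"
    by (simp add: G_def fps_eq_iff fps_mult_nth atLeast0AtMost)
  \<comment> \<open>Indices k > p get the default 0; indices k \<ge> n drop out because Q has degree
    below n.\<close>
  also have "\<dots> = (\<Sum>k<n. (if k \<le> p then fps_nth H (p - k) else 0) * fps_nth Q k)"
  proof (rule sum.mono_neutral_cong)
    show "fps_nth Q k * fps_nth H (p - k) = 0" if "k \<in> {..p} - {..<n}" for k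
      unfolding Q_def L_def using that \<open>j < n\<close> by (subst fps_nth_prod_linear_eq_0) auto
  qed (auto simp: mult.commute)
  finally show ?thesis
    by (simp add: Q_def L_def)
qed

lemma det_mat_eq_sum:
  "det (mat n n f) = (\<Sum>\<sigma> | \<sigma> permutes {..<n}. of_int (sign \<sigma>) * (\<Prod>i<n. f (i, \<sigma> i)))"
proof -
  have "(\<Prod>i<n. mat n n f $$ (i, \<sigma> i)) = (\<Prod>i<n. f (i, \<sigma> i))" if "\<sigma> permutes {..<n}" for \<sigma>
    using permutes_in_image[OF that] by (intro prod.cong) auto
  then show ?thesis
    by (subst det_def'[of _ n]) (simp_all add: atLeast0LessThan)
qed

text \<open>The matrix of powers is the Jacobi-Trudi matrix times a matrix E that does not involve
  \<alpha>, so determinants multiply. D stays existential: only its independence of \<alpha> matters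
  here, and \<alpha> = 0 identifies it later.\<close>

lemma ex_jacobi_trudi_factor:
  fixes x :: "nat \<Rightarrow> 'a::comm_ring_1"
  assumes H: "H * (\<Prod>i<n. 1 - fps_const (x i) * fps_X) = 1"
  shows "\<exists>D. \<forall>\<alpha>. (\<Sum>\<sigma> | \<sigma> permutes {..<n}. of_int (sign \<sigma>) *
           (\<Prod>i<n. x (\<sigma> i) ^ (n - 1 - i + \<alpha> i))) = jacobi_trudi n (fps_nth H) \<alpha> * D"
proof (intro exI allI)
  fix \<alpha> :: "nat \<Rightarrow> nat"
  define e where "e j = fps_nth (\<Prod>i\<in>{..<n} - {j}. 1 - fps_const (x i) * fps_X)" for j
  \<comment> \<open>The rows of E are reversed, so that the index
    \<open>n - 1 - i + \<alpha> i - k\<close> becomes \<open>\<alpha> i + k - i\<close> once k is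
    replaced by \<open>n - 1 - k\<close>.\<close>
  define E where "E = mat n n (\<lambda>(k, j). e j (n - 1 - k))"
  define A where "A = mat n n (\<lambda>(i, j). x j ^ (n - 1 - i + \<alpha> i))"
  define B where "B = mat n n (\<lambda>(i, j). if i \<le> \<alpha> i + j then fps_nth H (\<alpha> i + j - i) else 0)"
  have "A = B * E"
  proof (rule eq_matI)
    fix i j assume "i < dim_row (B * E)" "j < dim_col (B * E)"
    then have ij: "i < n" "j < n"
      by (auto simp: B_def E_def)
    have "x j ^ (n - 1 - i + \<alpha> i)
        = (\<Sum>k<n. (if k \<le> n - 1 - i + \<alpha> i then fps_nth H (n - 1 - i + \<alpha> i - k) else 0) * e j k)"
      unfolding e_def by (rule power_eq_sum_complete[OF H ij(2)])
    also have "\<dots> = (\<Sum>k<n. (if n - Suc k \<le> n - 1 - i + \<alpha> i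
          then fps_nth H (n - 1 - i + \<alpha> i - (n - Suc k)) else 0) * e j (n - Suc k))"
      by (rule sum.nat_diff_reindex[symmetric])
    also have "\<dots> = (\<Sum>k<n. (if i \<le> \<alpha> i + k then fps_nth H (\<alpha> i + k - i) else 0) * e j (n - 1 - k))"
    proof (rule sum.cong)
      fix k assume "k \<in> {..<n}"
      \<comment> \<open>As i < n and k < n, the subtractions \<open>n - 1 - i\<close> and
        \<open>n - Suc k\<close> are not truncated.\<close>
      then have "n - Suc k \<le> n - 1 - i + \<alpha> i \<longleftrightarrow> i \<le> \<alpha> i + k"
        and "i \<le> \<alpha> i + k \<Longrightarrow> n - 1 - i + \<alpha> i - (n - Suc k) = \<alpha> i + k - i"
        using ij by auto
      then show "(if n - Suc k \<le> n - 1 - i + \<alpha> i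
          then fps_nth H (n - 1 - i + \<alpha> i - (n - Suc k)) else 0) * e j (n - Suc k)
        = (if i \<le> \<alpha> i + k then fps_nth H (\<alpha> i + k - i) else 0) * e j (n - 1 - k)"
        by auto
    qed simp
    also have "\<dots> = (B * E) $$ (i, j)"
      using ij by (simp add: B_def E_def scalar_prod_def atLeast0LessThan)
    finally show "A $$ (i, j) = (B * E) $$ (i, j)"
      using ij by (simp add: A_def)
  qed (simp_all add: A_def B_def E_def)
  moreover have "A \<in> carrier_mat n n" "B \<in> carrier_mat n n" "E \<in> carrier_mat n n"
    by (simp_all add: A_def B_def E_def)
  ultimately have "det A = det B * det E"
    by (simp add: det_mult)
  moreover have "det A = (\<Sum>\<sigma> | \<sigma> permutes {..<n}. of_int (sign \<sigma>) *
           (\<Prod>i<n. x (\<sigma> i) ^ (n - 1 - i + \<alpha> i)))"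
    by (simp add: A_def det_mat_eq_sum)
  moreover have "det B = jacobi_trudi n (fps_nth H) \<alpha>"
    by (simp add: B_def det_mat_eq_sum jacobi_trudi_def)
  ultimately show "(\<Sum>\<sigma> | \<sigma> permutes {..<n}. of_int (sign \<sigma>) *
           (\<Prod>i<n. x (\<sigma> i) ^ (n - 1 - i + \<alpha> i))) = jacobi_trudi n (fps_nth H) \<alpha> *
      det (mat n n (\<lambda>(k, j). fps_nth (\<Prod>i\<in>{..<n} - {j}. 1 - fps_const (x i) * fps_X) (n - 1 - k)))"
    by (simp add: E_def e_def)
qed

text \<open>With \<open>\<alpha> n = 0\<close> the last row of the larger matrix is zero except for
  its final entry \<open>h 0 = 1\<close>.\<close>

lemma jacobi_trudi_Suc:
  assumes "\<alpha> n = 0" "h 0 = 1"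
  shows "jacobi_trudi (Suc n) h \<alpha> = jacobi_trudi n h \<alpha>"
proof -
  let ?F = "\<lambda>n \<sigma>. of_int (sign \<sigma>) * (\<Prod>i<n. if i \<le> \<alpha> i + \<sigma> i then h (\<alpha> i + \<sigma> i - i) else 0)"
  have "(\<Sum>\<sigma> | \<sigma> permutes {..<Suc n}. ?F (Suc n) \<sigma>) = (\<Sum>\<sigma> | \<sigma> permutes {..<n}. ?F n \<sigma>)"
  proof (rule sum.mono_neutral_cong_right)
    show "{\<sigma>. \<sigma> permutes {..<n}} \<subseteq> {\<sigma>. \<sigma> permutes {..<Suc n}}"
      by (auto elim!: permutes_subset)
    show "\<forall>\<sigma>\<in>{\<sigma>. \<sigma> permutes {..<Suc n}} - {\<sigma>. \<sigma> permutes {..<n}}. ?F (Suc n) \<sigma> = 0"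
    proof
      fix \<sigma> assume \<sigma>: "\<sigma> \<in> {\<sigma>. \<sigma> permutes {..<Suc n}} - {\<sigma>. \<sigma> permutes {..<n}}"
      \<comment> \<open>A permutation that moves n sends it below n, which selects a zero of the
        last row.\<close>
      have "\<sigma> n \<noteq> n"
        using \<sigma> permutes_superset[of \<sigma> "{..<Suc n}" "{..<n}"] by (auto simp: less_Suc_eq)
      moreover have "\<sigma> n < Suc n"
        using \<sigma> permutes_in_image[of \<sigma> "{..<Suc n}" n] by auto
      ultimately show "?F (Suc n) \<sigma> = 0"
        using assms by simp
    qed
    show "?F (Suc n) \<sigma> = ?F n \<sigma>" if "\<sigma> \<in> {\<sigma>. \<sigma> permutes {..<n}}" for \<sigma>
      using that assms permutes_not_in[of \<sigma> "{..<n}" n] by simp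
  qed (simp add: finite_permutations)
  then show ?thesis
    by (simp add: jacobi_trudi_def)
qed

lemma jacobi_trudi_mono:
  assumes "m \<le> n" "\<And>i. m \<le> i \<Longrightarrow> \<alpha> i = 0" "h 0 = 1"
  shows "jacobi_trudi n h \<alpha> = jacobi_trudi m h \<alpha>"
  using assms(1)
  by (induction n rule: dec_induct) (simp_all add: jacobi_trudi_Suc assms)

lemma jacobi_trudi_0 [simp]:
  assumes "h 0 = 1"
  shows "jacobi_trudi n h (\<lambda>_. 0) = 1"
proof -
  have "jacobi_trudi n h (\<lambda>_. 0) = jacobi_trudi 0 h (\<lambda>_. 0)"
    by (rule jacobi_trudi_mono) (use assms in auto)
  then show ?thesis
    by (simp add: jacobi_trudi_def)
qed

subsection \<open>Compositions\<close>

lemma lookup_map_key: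
  "inj f \<Longrightarrow> Poly_Mapping.lookup (Poly_Mapping.map_key f p) k = Poly_Mapping.lookup p (f k)"
  by (simp add: map_key.rep_eq)

lemma vectors_iff: "\<alpha> \<in> vectors n \<longleftrightarrow> (\<forall>i\<ge>n. Poly_Mapping.lookup \<alpha> i = 0)"
  by (auto simp: vectors_def in_keys_iff not_less[symmetric])

lemma add_in_vectors_iff: "\<alpha> + \<beta> \<in> vectors n \<longleftrightarrow> \<alpha> \<in> vectors n \<and> \<beta> \<in> vectors n"
  by (auto simp: vectors_iff lookup_add)

lemma vectors_mono: "m \<le> n \<Longrightarrow> \<alpha> \<in> vectors m \<Longrightarrow> \<alpha> \<in> vectors n"
  by (auto simp: vectors_iff)

lemma ex_vectors: "\<exists>n. \<alpha> \<in> vectors n"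
  using finite_nat_set_iff_bounded[of "Poly_Mapping.keys \<alpha>"] by (auto simp: vectors_def)

lemma weight_eq_sum:
  assumes "finite A" "Poly_Mapping.keys \<alpha> \<subseteq> A"
  shows "weight \<alpha> = (\<Sum>i\<in>A. Poly_Mapping.lookup \<alpha> i)"
  unfolding weight_def by (rule sum.mono_neutral_left) (use assms in \<open>auto simp: in_keys_iff\<close>)

lemma weight_add: "weight (\<alpha> + \<beta>) = weight \<alpha> + weight \<beta>"
proof -
  let ?A = "Poly_Mapping.keys \<alpha> \<union> Poly_Mapping.keys \<beta>"
  have "weight (\<alpha> + \<beta>) = (\<Sum>i\<in>?A. Poly_Mapping.lookup (\<alpha> + \<beta>) i)"
    using keys_add[of \<alpha> \<beta>] by (intro weight_eq_sum) auto
  also have "\<dots> = (\<Sum>i\<in>?A. Poly_Mapping.lookup \<alpha> i) + (\<Sum>i\<in>?A. Poly_Mapping.lookup \<beta> i)"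
    by (simp add: lookup_add sum.distrib)
  also have "\<dots> = weight \<alpha> + weight \<beta>"
    by (simp add: weight_eq_sum[of ?A])
  finally show ?thesis .
qed

lemma weight_single [simp]: "weight (Poly_Mapping.single i k) = k"
  by (simp add: weight_eq_sum[of "{i}"])

lemma lookup_le_weight: "Poly_Mapping.lookup \<alpha> i \<le> weight \<alpha>"
proof -
  have "weight \<alpha> = (\<Sum>i\<in>insert i (Poly_Mapping.keys \<alpha>). Poly_Mapping.lookup \<alpha> i)"
    by (rule weight_eq_sum) auto
  then show ?thesis
    by (simp add: sum.insert_remove)
qed

lemma weight_map_key:
  assumes "bij \<pi>"
  shows "weight (Poly_Mapping.map_key \<pi> \<alpha>) = weight \<alpha>"
proof -
  have inj: "inj \<pi>"
    using assms by (rule bij_is_inj)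
  have "Poly_Mapping.keys \<alpha> = \<pi> ` Poly_Mapping.keys (Poly_Mapping.map_key \<pi> \<alpha>)"
    using assms by (simp add: keys_map_key[OF inj] bij_is_surj surj_image_vimage_eq)
  then show ?thesis
    unfolding weight_def
    by (simp add: sum.reindex[OF inj_on_subset[OF inj subset_UNIV]] lookup_map_key[OF inj])
qed

lemma map_key_inv:
  assumes "bij \<pi>"
  shows "Poly_Mapping.map_key \<pi> (Poly_Mapping.map_key (Hilbert_Choice.inv \<pi>) \<alpha>) = \<alpha>"
    "Poly_Mapping.map_key (Hilbert_Choice.inv \<pi>) (Poly_Mapping.map_key \<pi> \<alpha>) = \<alpha>"
  using assms
  by (auto intro!: poly_mapping_eqI
      simp: lookup_map_key bij_is_inj bij_imp_bij_inv bij_inv_eq_iff surj_f_inv_f bij_is_surj)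

subsection \<open>Symmetric functions\<close>

lemma coeff_times: "coeff (f * g) \<alpha> = (\<Sum>(\<beta>, \<gamma>)\<in>splits \<alpha>. coeff f \<beta> * coeff g \<gamma>)"
  by transfer simp

lemma LambdaI:
  assumes "\<And>\<alpha>. coeff f \<alpha> \<noteq> 0 \<Longrightarrow> weight \<alpha> \<le> d"
    and "\<And>\<pi> \<alpha>. bij \<pi> \<Longrightarrow> coeff f (Poly_Mapping.map_key \<pi> \<alpha>) = coeff f \<alpha>"
  shows "f \<in> Lambda"
  using assms unfolding Lambda_def by blast

lemma Lambda_bounded:
  assumes "f \<in> Lambda"
  obtains d where "\<And>\<alpha>. coeff f \<alpha> \<noteq> 0 \<Longrightarrow> weight \<alpha> \<le> d"
  using assms unfolding Lambda_def by blast

lemma Lambda_symmetric: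
  "f \<in> Lambda \<Longrightarrow> bij \<pi> \<Longrightarrow> coeff f (Poly_Mapping.map_key \<pi> \<alpha>) = coeff f \<alpha>"
  by (auto simp: Lambda_def)

lemma Lambda_0 [simp]: "0 \<in> Lambda"
  by (rule LambdaI) (simp_all add: zero_pseries.rep_eq)

lemma Lambda_1 [simp]: "1 \<in> Lambda"
proof (rule LambdaI)
  fix \<pi> :: "nat \<Rightarrow> nat" and \<alpha> :: composition assume "bij \<pi>"
  then have "Poly_Mapping.map_key \<pi> \<alpha> = 0 \<longleftrightarrow> \<alpha> = 0"
    by (metis map_key_inv(2) map_key_zero bij_imp_bij_inv bij_is_inj)
  then show "coeff 1 (Poly_Mapping.map_key \<pi> \<alpha>) = coeff 1 \<alpha>"
    by (simp add: one_pseries.rep_eq)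
qed (auto simp: one_pseries.rep_eq weight_def split: if_splits)

lemma Lambda_add [intro]:
  assumes "f \<in> Lambda" "g \<in> Lambda"
  shows "f + g \<in> Lambda"
proof -
  obtain d e where de: "\<And>\<alpha>. coeff f \<alpha> \<noteq> 0 \<Longrightarrow> weight \<alpha> \<le> d" "\<And>\<alpha>. coeff g \<alpha> \<noteq> 0 \<Longrightarrow> weight \<alpha> \<le> e"
    using Lambda_bounded[OF assms(1)] Lambda_bounded[OF assms(2)] by metis
  show ?thesis
  proof (rule LambdaI)
    fix \<alpha> assume "coeff (f + g) \<alpha> \<noteq> 0"
    then have "coeff f \<alpha> \<noteq> 0 \<or> coeff g \<alpha> \<noteq> 0"
      by (auto simp: plus_pseries.rep_eq)
    then show "weight \<alpha> \<le> max d e"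
      using de[of \<alpha>] by auto
  qed (simp add: plus_pseries.rep_eq Lambda_symmetric assms)
qed

lemma Lambda_uminus [intro]: "f \<in> Lambda \<Longrightarrow> - f \<in> Lambda"
  by (simp add: Lambda_def uminus_pseries.rep_eq)

lemma Lambda_mult [intro]:
  assumes "f \<in> Lambda" "g \<in> Lambda"
  shows "f * g \<in> Lambda"
proof -
  obtain d e where de: "\<And>\<alpha>. coeff f \<alpha> \<noteq> 0 \<Longrightarrow> weight \<alpha> \<le> d" "\<And>\<alpha>. coeff g \<alpha> \<noteq> 0 \<Longrightarrow> weight \<alpha> \<le> e"
    using Lambda_bounded[OF assms(1)] Lambda_bounded[OF assms(2)] by metis
  show ?thesis
  proof (rule LambdaI)
    fix \<alpha> assume "coeff (f * g) \<alpha> \<noteq> 0"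
    then obtain \<beta> \<gamma> where "\<beta> + \<gamma> = \<alpha>" "coeff f \<beta> * coeff g \<gamma> \<noteq> 0"
      unfolding coeff_times by (auto elim!: sum.not_neutral_contains_not_neutral simp: splits_def)
    then show "weight \<alpha> \<le> d + e"
      using de(1)[of \<beta>] de(2)[of \<gamma>] by (auto simp: weight_add)
  next
    fix \<pi> :: "nat \<Rightarrow> nat" and \<alpha> :: composition assume \<pi>: "bij \<pi>"
    then have inj: "inj \<pi>" "inj (Hilbert_Choice.inv \<pi>)"
      by (auto simp: bij_is_inj bij_imp_bij_inv)
    show "coeff (f * g) (Poly_Mapping.map_key \<pi> \<alpha>) = coeff (f * g) \<alpha>"
      unfolding coeff_times
      by (rule sum.reindex_bij_witness[of _
            "map_prod (Poly_Mapping.map_key \<pi>) (Poly_Mapping.map_key \<pi>)"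
            "map_prod (Poly_Mapping.map_key (Hilbert_Choice.inv \<pi>)) (Poly_Mapping.map_key (Hilbert_Choice.inv \<pi>))"])
        (auto simp: splits_def map_key_inv[OF \<pi>] map_key_plus[OF inj(2), symmetric] map_key_plus[OF inj(1)]
          Lambda_symmetric[OF _ bij_imp_bij_inv[OF \<pi>]] assms)
  qed
qed

lemma Lambda_of_int [simp]: "of_int k \<in> Lambda"
proof -
  have "of_nat n \<in> Lambda" for n
    by (induction n) auto
  then show ?thesis
    by (cases k) (auto simp del: of_nat_Suc)
qed

lemma Lambda_sum [intro]: "(\<And>i. i \<in> A \<Longrightarrow> f i \<in> Lambda) \<Longrightarrow> sum f A \<in> Lambda"
  by (induction A rule: infinite_finite_induct) auto

lemma Lambda_prod [intro]: "(\<And>i. i \<in> A \<Longrightarrow> f i \<in> Lambda) \<Longrightarrow> prod f A \<in> Lambda"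
  by (induction A rule: infinite_finite_induct) auto

text \<open>Every composition lies in some \<open>vectors n\<close>, so each coefficient is seen by
  a truncation. This reduces identities in \<open>Lambda\<close> to finitely many
  indeterminates.\<close>

lemma Lambda_eqI:
  assumes "f \<in> Lambda" "g \<in> Lambda" "\<And>n. truncate n f = truncate n g"
  shows "f = g"
proof (rule pseries_eqI)
  fix \<alpha>
  obtain n where n: "\<alpha> \<in> vectors n"
    using ex_vectors by blast
  have "Poly_Mapping.lookup (truncate n f) \<alpha> = Poly_Mapping.lookup (truncate n g) \<alpha>"
    using assms by simp
  then show "coeff f \<alpha> = coeff g \<alpha>"
    using n by (simp add: lookup_truncate assms(1,2))
qed

section \<open>Setting indeterminates to zero as a ring homomorphism\<close>

lemma lookup_mult_splits:
  fixes p q :: int_mpoly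
  shows "Poly_Mapping.lookup (p * q) \<kappa> =
    (\<Sum>(\<beta>, \<gamma>)\<in>splits \<kappa>. Poly_Mapping.lookup p \<beta> * Poly_Mapping.lookup q \<gamma>)"
proof -
  have "Poly_Mapping.lookup (p * q) \<kappa> =
      (\<Sum>(\<beta>, \<gamma>). Poly_Mapping.lookup p \<beta> * Poly_Mapping.lookup q \<gamma> when \<kappa> = \<beta> + \<gamma>)"
    by (simp add: times_poly_mapping.rep_eq prod_fun_unfold_prod)
  also have "\<dots> = (\<Sum>(\<beta>, \<gamma>)\<in>splits \<kappa>. Poly_Mapping.lookup p \<beta> * Poly_Mapping.lookup q \<gamma> when \<kappa> = \<beta> + \<gamma>)"
    by (rule Sum_any.expand_superset[OF finite_splits]) (auto simp: splits_def)
  also have "\<dots> = (\<Sum>(\<beta>, \<gamma>)\<in>splits \<kappa>. Poly_Mapping.lookup p \<beta> * Poly_Mapping.lookup q \<gamma>)"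
    by (rule sum.cong) (auto simp: splits_def)
  finally show ?thesis .
qed

lemma truncate_0 [simp]: "truncate n 0 = 0"
  by (rule poly_mapping_eqI) (simp add: lookup_truncate zero_pseries.rep_eq)

lemma truncate_1 [simp]: "truncate n 1 = 1"
  by (rule poly_mapping_eqI)
    (auto simp add: lookup_truncate one_pseries.rep_eq lookup_one vectors_iff when_def)

lemma truncate_add:
  "f \<in> Lambda \<Longrightarrow> g \<in> Lambda \<Longrightarrow> truncate n (f + g) = truncate n f + truncate n g"
  by (rule poly_mapping_eqI)
    (simp add: lookup_truncate Lambda_add plus_pseries.rep_eq lookup_add)

lemma truncate_uminus: "f \<in> Lambda \<Longrightarrow> truncate n (- f) = - truncate n f"
  by (rule poly_mapping_eqI)
    (simp add: lookup_truncate Lambda_uminus uminus_pseries.rep_eq)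

text \<open>A sum of compositions lies in \<open>vectors n\<close> exactly when both summands do;
  hence dropping the monomials outside \<open>vectors n\<close> respects products.\<close>

lemma truncate_mult:
  assumes "f \<in> Lambda" "g \<in> Lambda"
  shows "truncate n (f * g) = truncate n f * truncate n g"
proof (rule poly_mapping_eqI)
  fix \<kappa>
  have "(if \<kappa> \<in> vectors n then coeff f \<beta> * coeff g \<gamma> else 0)
      = Poly_Mapping.lookup (truncate n f) \<beta> * Poly_Mapping.lookup (truncate n g) \<gamma>"
    if "(\<beta>, \<gamma>) \<in> splits \<kappa>" for \<beta> \<gamma>
    using that by (auto simp: splits_def lookup_truncate assms add_in_vectors_iff)
  then have "(\<Sum>(\<beta>, \<gamma>)\<in>splits \<kappa>. if \<kappa> \<in> vectors n then coeff f \<beta> * coeff g \<gamma> else 0)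
     = Poly_Mapping.lookup (truncate n f * truncate n g) \<kappa>"
    unfolding lookup_mult_splits by (intro sum.cong) auto
  then show "Poly_Mapping.lookup (truncate n (f * g)) \<kappa> = Poly_Mapping.lookup (truncate n f * truncate n g) \<kappa>"
    by (cases "\<kappa> \<in> vectors n") (simp_all add: lookup_truncate Lambda_mult assms coeff_times)
qed

lemma truncate_of_int [simp]: "truncate n (of_int k) = of_int k"
proof -
  have "of_nat m \<in> Lambda \<and> truncate n (of_nat m) = of_nat m" for m
    by (induction m) (auto simp: truncate_add)
  then show ?thesis
    by (cases k) (auto simp: truncate_uminus truncate_add simp del: of_nat_Suc)
qed

lemma truncate_sum:
  "(\<And>i. i \<in> A \<Longrightarrow> f i \<in> Lambda) \<Longrightarrow> truncate n (sum f A) = (\<Sum>i\<in>A. truncate n (f i))"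
  by (induction A rule: infinite_finite_induct) (auto simp: truncate_add Lambda_sum)

lemma truncate_prod:
  "(\<And>i. i \<in> A \<Longrightarrow> f i \<in> Lambda) \<Longrightarrow> truncate n (prod f A) = (\<Prod>i\<in>A. truncate n (f i))"
  by (induction A rule: infinite_finite_induct) (auto simp: truncate_mult Lambda_prod)

text \<open>The substitution \<open>X i = 0\<close> for i \<ge> n, on polynomials. It is applied to
  alternants, which in general are not truncations of members of \<open>Lambda\<close>.\<close>

definition cut :: "nat \<Rightarrow> int_mpoly \<Rightarrow> int_mpoly" where
  "cut n = Poly_Mapping.mapp (\<lambda>\<alpha> c. if \<alpha> \<in> vectors n then c else 0)"

lemma lookup_cut:
  "Poly_Mapping.lookup (cut n p) \<alpha> = (if \<alpha> \<in> vectors n then Poly_Mapping.lookup p \<alpha> else 0)"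
  by (auto simp: cut_def lookup_mapp when_def in_keys_iff)

lemma cut_mult: "cut n (p * q) = cut n p * cut n q"
proof (rule poly_mapping_eqI)
  fix \<kappa>
  have "(if \<kappa> \<in> vectors n then Poly_Mapping.lookup p \<beta> * Poly_Mapping.lookup q \<gamma> else 0)
      = Poly_Mapping.lookup (cut n p) \<beta> * Poly_Mapping.lookup (cut n q) \<gamma>"
    if "(\<beta>, \<gamma>) \<in> splits \<kappa>" for \<beta> \<gamma>
    using that by (auto simp: splits_def lookup_cut add_in_vectors_iff)
  then have "(\<Sum>(\<beta>, \<gamma>)\<in>splits \<kappa>. if \<kappa> \<in> vectors n then Poly_Mapping.lookup p \<beta> * Poly_Mapping.lookup q \<gamma> else 0)
     = Poly_Mapping.lookup (cut n p * cut n q) \<kappa>"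
    unfolding lookup_mult_splits by (intro sum.cong) auto
  moreover have "Poly_Mapping.lookup (cut n (p * q)) \<kappa>
      = (\<Sum>(\<beta>, \<gamma>)\<in>splits \<kappa>. if \<kappa> \<in> vectors n then Poly_Mapping.lookup p \<beta> * Poly_Mapping.lookup q \<gamma> else 0)"
    by (simp add: lookup_cut lookup_mult_splits)
  ultimately show "Poly_Mapping.lookup (cut n (p * q)) \<kappa> = Poly_Mapping.lookup (cut n p * cut n q) \<kappa>"
    by simp
qed

lemma cut_truncate:
  "f \<in> Lambda \<Longrightarrow> m \<le> n \<Longrightarrow> cut m (truncate n f) = truncate m f"
  by (rule poly_mapping_eqI) (auto simp: lookup_cut lookup_truncate dest: vectors_mono)

subsection \<open>Complete symmetric functions\<close>

definition complete :: "nat \<Rightarrow> pseries" where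
  "complete k = Pseries (\<lambda>\<alpha>. if weight \<alpha> = k then 1 else 0)"

lemma coeff_complete [simp]: "coeff (complete k) \<alpha> = (if weight \<alpha> = k then 1 else 0)"
  by (simp add: complete_def Pseries_inverse)

lemma complete_in_Lambda [simp]: "complete k \<in> Lambda"
  by (rule LambdaI[of _ k]) (auto simp: weight_map_key split: if_splits)

lemma weight_eq_0_iff: "weight \<alpha> = 0 \<longleftrightarrow> \<alpha> = 0"
  by (auto simp: weight_def in_keys_iff intro!: poly_mapping_eqI)

lemma complete_0 [simp]: "complete 0 = 1"
  by (rule pseries_eqI) (simp add: one_pseries.rep_eq weight_eq_0_iff)

lemma lookup_X_mult:
  "Poly_Mapping.lookup (X n * p) (Poly_Mapping.single n 1 + \<kappa>) = Poly_Mapping.lookup p \<kappa>"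
proof -
  have "Poly_Mapping.lookup (X n * p) (Poly_Mapping.single n 1 + \<kappa>)
      = (\<Sum>(\<beta>, \<gamma>)\<in>{(Poly_Mapping.single n 1, \<kappa>)}. Poly_Mapping.lookup (X n) \<beta> * Poly_Mapping.lookup p \<gamma>)"
    unfolding lookup_mult_splits
    by (rule sum.mono_neutral_right[OF finite_splits])
      (auto simp: splits_def X_def lookup_single when_def split: if_splits)
  then show ?thesis
    by (simp add: X_def)
qed

lemma lookup_X_mult_eq_0:
  assumes "Poly_Mapping.lookup \<kappa> n = 0"
  shows "Poly_Mapping.lookup (X n * p) \<kappa> = 0"
  unfolding lookup_mult_splits
  using assms by (intro sum.neutral) (auto simp: splits_def X_def lookup_single when_def lookup_add)

text \<open>A monomial of degree k + 1 in n + 1 indeterminates either avoids \<open>X n\<close> or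
  is \<open>X n\<close> times a monomial of degree k.\<close>

lemma truncate_complete_Suc:
  "truncate (Suc n) (complete (Suc k)) = truncate n (complete (Suc k)) + X n * truncate (Suc n) (complete k)"
proof (rule poly_mapping_eqI)
  fix \<kappa> :: composition
  show "Poly_Mapping.lookup (truncate (Suc n) (complete (Suc k))) \<kappa> =
     Poly_Mapping.lookup (truncate n (complete (Suc k)) + X n * truncate (Suc n) (complete k)) \<kappa>"
  proof (cases "Poly_Mapping.lookup \<kappa> n = 0")
    case True
    moreover from True have "\<kappa> \<in> vectors (Suc n) \<longleftrightarrow> \<kappa> \<in> vectors n"
      by (auto simp: vectors_iff le_Suc_eq) (metis Suc_leI le_neq_implies_less)
    ultimately show ?thesis
      by (simp add: lookup_add lookup_truncate lookup_X_mult_eq_0)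
  next
    case False
    define \<kappa>' where "\<kappa>' = \<kappa> - Poly_Mapping.single n 1"
    have \<kappa>: "\<kappa> = Poly_Mapping.single n 1 + \<kappa>'"
      using False by (intro poly_mapping_eqI)
        (auto simp: \<kappa>'_def lookup_add lookup_minus lookup_single when_def)
    have "Poly_Mapping.single n 1 \<in> vectors (Suc n)"
      by (auto simp: vectors_iff lookup_single when_def)
    moreover have "\<kappa> \<notin> vectors n"
      using False by (auto simp: vectors_iff)
    ultimately show ?thesis
      unfolding \<kappa> lookup_add lookup_X_mult
      by (simp add: lookup_truncate add_in_vectors_iff weight_add)
  qed
qed

lemma truncate_0_complete: "truncate 0 (complete k) = (if k = 0 then 1 else 0)"
  by (rule poly_mapping_eqI)
    (auto simp: lookup_truncate vectors_def lookup_one when_def weight_def)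

text \<open>By the recurrence, multiplying by the factor of \<open>X n\<close> turns the generating
  series for n + 1 indeterminates into the one for n.\<close>

lemma complete_mult_prod:
  "Abs_fps (\<lambda>k. truncate n (complete k)) * (\<Prod>i<n. 1 - fps_const (X i) * fps_X) = 1"
proof (induction n)
  case 0
  show ?case
    by (simp add: fps_eq_iff truncate_0_complete)
next
  case (Suc n)
  let ?H = "\<lambda>n. Abs_fps (\<lambda>k. truncate n (complete k))"
  have "fps_nth (?H (Suc n) * (1 - fps_const (X n) * fps_X)) k = fps_nth (?H n) k" for k
    by (cases k) (simp_all add: truncate_complete_Suc algebra_simps)
  then have "?H (Suc n) * (1 - fps_const (X n) * fps_X) = ?H n"
    by (simp add: fps_eq_iff)
  moreover have "?H (Suc n) * (\<Prod>i<Suc n. 1 - fps_const (X i) * fps_X)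
      = ?H (Suc n) * (1 - fps_const (X n) * fps_X) * (\<Prod>i<n. 1 - fps_const (X i) * fps_X)"
    by (simp add: algebra_simps)
  ultimately show ?case
    using Suc by simp
qed

lemma jacobi_trudi_in_Lambda: "(\<And>k. h k \<in> Lambda) \<Longrightarrow> jacobi_trudi n h \<alpha> \<in> Lambda"
  unfolding jacobi_trudi_def by (intro Lambda_sum Lambda_mult Lambda_prod Lambda_of_int) auto

lemma truncate_jacobi_trudi:
  assumes "\<And>k. h k \<in> Lambda"
  shows "truncate m (jacobi_trudi n h \<alpha>) = jacobi_trudi n (\<lambda>k. truncate m (h k)) \<alpha>"
proof -
  have "(if P then h k else 0) \<in> Lambda" and "truncate m (if P then h k else 0) = (if P then truncate m (h k) else 0)" for P k
    using assms by auto
  then show ?thesis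
    unfolding jacobi_trudi_def
    by (simp add: truncate_sum truncate_mult truncate_prod Lambda_mult Lambda_prod)
qed

subsection \<open>Alternants\<close>

lemma X_power: "X i ^ k = Poly_Mapping.single (Poly_Mapping.single i k) 1"
  by (induction k) (simp_all add: X_def mult_single single_add[symmetric])

lemma prod_single_1:
  "(\<Prod>i\<in>A. Poly_Mapping.single (g i) 1 :: int_mpoly) = Poly_Mapping.single (\<Sum>i\<in>A. g i) 1"
  by (induction A rule: infinite_finite_induct) (simp_all add: mult_single)

lemma single_times_of_int:
  "of_int c * Poly_Mapping.single \<alpha> 1 = (Poly_Mapping.single \<alpha> c :: int_mpoly)"
  by (simp flip: single_of_int add: mult_single)

text \<open>The indeterminate \<open>X k\<close> receives the exponent of \<gamma> at the preimage
  of k, hence the inverse of \<sigma>.\<close>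

lemma prod_X_permutes:
  assumes "\<sigma> permutes {..<n}" "\<gamma> \<in> vectors n"
  shows "(\<Prod>i<n. X (\<sigma> i) ^ Poly_Mapping.lookup \<gamma> i)
    = Poly_Mapping.single (Poly_Mapping.map_key (Hilbert_Choice.inv \<sigma>) \<gamma>) 1"
proof -
  let ?\<tau> = "Hilbert_Choice.inv \<sigma>"
  have "(\<Sum>i<n. Poly_Mapping.single (\<sigma> i) (Poly_Mapping.lookup \<gamma> i)) = Poly_Mapping.map_key ?\<tau> \<gamma>"
  proof (rule poly_mapping_eqI)
    fix k
    have "\<sigma> i = k \<longleftrightarrow> i = ?\<tau> k" for i
      using permutes_inv_eq[OF assms(1)] by metis
    moreover have "Poly_Mapping.lookup \<gamma> (?\<tau> k) = 0" if "\<not> ?\<tau> k < n"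
      using that assms(2) by (simp add: vectors_iff)
    moreover have "inj ?\<tau>"
      using permutes_inj permutes_inv assms(1) by blast
    ultimately show "Poly_Mapping.lookup (\<Sum>i<n. Poly_Mapping.single (\<sigma> i) (Poly_Mapping.lookup \<gamma> i)) k
        = Poly_Mapping.lookup (Poly_Mapping.map_key ?\<tau> \<gamma>) k"
      by (auto simp: lookup_sum lookup_single when_def lookup_map_key)
  qed
  then show ?thesis
    by (simp add: X_power prod_single_1)
qed

text \<open>Replacing \<sigma> by its inverse, which has the same sign, gives the form with
  \<open>map_key \<sigma>\<close> in which the symmetry of f is stated.\<close>

lemma alternant_eq:
  assumes "\<gamma> \<in> vectors n"
  shows "alternant n \<gamma> =
    (\<Sum>\<sigma> | \<sigma> permutes {..<n}. Poly_Mapping.single (Poly_Mapping.map_key \<sigma> \<gamma>) (sign \<sigma>))"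
proof -
  have "alternant n \<gamma> = (\<Sum>\<sigma> | \<sigma> permutes {..<n}.
      Poly_Mapping.single (Poly_Mapping.map_key (Hilbert_Choice.inv \<sigma>) \<gamma>) (sign (Hilbert_Choice.inv \<sigma>)))"
    unfolding alternant_def
  proof (rule sum.cong)
    fix \<sigma> assume "\<sigma> \<in> {\<sigma>. \<sigma> permutes {..<n}}"
    then show "of_int (sign \<sigma>) * (\<Prod>i<n. X (\<sigma> i) ^ Poly_Mapping.lookup \<gamma> i) =
       Poly_Mapping.single (Poly_Mapping.map_key (Hilbert_Choice.inv \<sigma>) \<gamma>) (sign (Hilbert_Choice.inv \<sigma>))"
      using assms by (simp add: prod_X_permutes single_times_of_int sign_inverse
          permutes_imp_permutation[OF finite_lessThan])
  qed simp
  also have "\<dots> = (\<Sum>\<sigma> | \<sigma> permutes {..<n}. Poly_Mapping.single (Poly_Mapping.map_key \<sigma> \<gamma>) (sign \<sigma>))"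
    by (rule sum_permutations_inverse[symmetric])
  finally show ?thesis .
qed

lemma lookup_alternant:
  assumes "\<gamma> \<in> vectors n"
  shows "Poly_Mapping.lookup (alternant n \<gamma>) \<kappa> =
    (\<Sum>\<sigma> | \<sigma> permutes {..<n}. if Poly_Mapping.map_key \<sigma> \<gamma> = \<kappa> then sign \<sigma> else 0)"
  by (simp add: alternant_eq[OF assms] lookup_sum lookup_single when_def)

lemma lookup_staircase:
  "Poly_Mapping.lookup (staircase n) i = (if i < n then n - 1 - i else 0)"
  by (auto simp: staircase_def lookup_sum lookup_single when_def)

lemma staircase_in_vectors [simp]: "staircase n \<in> vectors n"
  by (simp add: vectors_iff lookup_staircase)

text \<open>The staircase has distinct entries at the positions below n, so only the identity
  contributes. Hence the alternant in the denominator is nonzero.\<close>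

lemma lookup_alternant_staircase:
  "Poly_Mapping.lookup (alternant n (staircase n)) (staircase n) = 1"
proof -
  have "\<sigma> = id" if \<sigma>: "\<sigma> permutes {..<n}" and eq: "Poly_Mapping.map_key \<sigma> (staircase n) = staircase n" for \<sigma>
  proof
    fix i
    have "Poly_Mapping.lookup (staircase n) (\<sigma> i) = Poly_Mapping.lookup (staircase n) i"
      using arg_cong[OF eq, of "\<lambda>p. Poly_Mapping.lookup p i"] permutes_inj[OF \<sigma>]
      by (simp add: lookup_map_key)
    then show "\<sigma> i = id i"
      using permutes_in_image[OF \<sigma>, of i] permutes_not_in[OF \<sigma>, of i]
      by (cases "i < n") (auto simp: lookup_staircase)
  qed
  moreover have "Poly_Mapping.map_key id (staircase n) = staircase n"
    by (rule poly_mapping_eqI) (simp add: lookup_map_key)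
  ultimately have "Poly_Mapping.lookup (alternant n (staircase n)) (staircase n)
      = (\<Sum>\<sigma> | \<sigma> permutes {..<n}. if \<sigma> = id then 1 else 0)"
    by (subst lookup_alternant) (auto intro!: sum.cong simp: sign_id)
  also have "\<dots> = 1"
    using permutes_id[of "{..<n}"] by (simp add: finite_permutations)
  finally show ?thesis .
qed

lemma alternant_staircase_nonzero: "alternant n (staircase n) \<noteq> 0"
  using lookup_alternant_staircase[of n] by auto

text \<open>In each monomial the exponent of \<open>X n\<close> is some entry of \<gamma> and so
  positive; none survives \<open>X n = 0\<close>.\<close>

lemma cut_alternant_eq_0:
  assumes "\<gamma> \<in> vectors (Suc n)" "\<And>i. i \<le> n \<Longrightarrow> Poly_Mapping.lookup \<gamma> i > 0"
  shows "cut n (alternant (Suc n) \<gamma>) = 0"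
proof (rule poly_mapping_eqI)
  fix \<kappa>
  have "Poly_Mapping.lookup (alternant (Suc n) \<gamma>) \<kappa> = 0" if \<kappa>: "\<kappa> \<in> vectors n"
    unfolding lookup_alternant[OF assms(1)]
  proof (intro sum.neutral ballI)
    fix \<sigma> assume "\<sigma> \<in> {\<sigma>. \<sigma> permutes {..<Suc n}}"
    then have \<sigma>: "\<sigma> permutes {..<Suc n}"
      by simp
    have "Poly_Mapping.lookup (Poly_Mapping.map_key \<sigma> \<gamma>) n > 0"
      using assms(2)[of "\<sigma> n"] permutes_in_image[OF \<sigma>, of n]
      by (simp add: lookup_map_key permutes_inj[OF \<sigma>])
    then show "(if Poly_Mapping.map_key \<sigma> \<gamma> = \<kappa> then sign \<sigma> else 0) = 0"
      using \<kappa> by (auto simp: vectors_iff)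
  qed
  then show "Poly_Mapping.lookup (cut n (alternant (Suc n) \<gamma>)) \<kappa> = Poly_Mapping.lookup 0 \<kappa>"
    by (simp add: lookup_cut)
qed

text \<open>The last entry of the staircase is 0, so its monomial, which has coefficient 1,
  survives.\<close>

lemma cut_alternant_staircase_nonzero: "cut n (alternant (Suc n) (staircase (Suc n))) \<noteq> 0"
proof -
  have "staircase (Suc n) \<in> vectors n"
    by (auto simp: vectors_iff lookup_staircase)
  then have "Poly_Mapping.lookup (cut n (alternant (Suc n) (staircase (Suc n)))) (staircase (Suc n)) = 1"
    by (simp add: lookup_cut lookup_alternant_staircase)
  then show ?thesis
    by auto
qed

lemma alternant_eq_0:
  assumes "i < n" "j < n" "i \<noteq> j" "Poly_Mapping.lookup \<gamma> i = Poly_Mapping.lookup \<gamma> j"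
  shows "alternant n \<gamma> = 0"
proof -
  define A where "A = mat n n (\<lambda>(i, j). X j ^ Poly_Mapping.lookup \<gamma> i)"
  have "alternant n \<gamma> = det A"
    by (simp add: A_def det_mat_eq_sum alternant_def)
  also have "\<dots> = 0"
    by (rule det_identical_rows[of _ n i j]) (use assms in \<open>auto simp: A_def\<close>)
  finally show ?thesis .
qed

lemma symmetric_times_alternant:
  assumes f: "f \<in> Lambda" and \<gamma>: "\<gamma> \<in> vectors n"
  shows "truncate n f * alternant n \<gamma> =
    (\<Sum>\<alpha>\<in>Poly_Mapping.keys (truncate n f). of_int (coeff f \<alpha>) * alternant n (\<gamma> + \<alpha>))"
proof -
  define K where "K = Poly_Mapping.keys (truncate n f)"
  have K: "\<alpha> \<in> K \<longleftrightarrow> \<alpha> \<in> vectors n \<and> coeff f \<alpha> \<noteq> 0" for \<alpha>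
    by (simp add: K_def in_keys_iff lookup_truncate f)
  have fin: "finite K"
    by (simp add: K_def)
  have *: "Poly_Mapping.single (Poly_Mapping.map_key \<sigma> \<gamma>) (sign \<sigma>) * truncate n f =
      (\<Sum>\<alpha>\<in>K. of_int (coeff f \<alpha>) * Poly_Mapping.single (Poly_Mapping.map_key \<sigma> (\<gamma> + \<alpha>)) (sign \<sigma>))"
    if \<sigma>: "\<sigma> permutes {..<n}" for \<sigma>
  proof -
    let ?\<tau> = "Hilbert_Choice.inv \<sigma>"
    have bij: "bij \<sigma>" and inj: "inj \<sigma>" and \<tau>: "?\<tau> permutes {..<n}" "bij ?\<tau>"
      using \<sigma> permutes_bij permutes_inj permutes_inv by blast+
    have vec: "Poly_Mapping.map_key \<rho> \<alpha> \<in> vectors n" if "\<alpha> \<in> vectors n" "\<rho> permutes {..<n}" for \<alpha> \<rho>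
      using that permutes_not_in[OF that(2)] by (auto simp: vectors_iff lookup_map_key permutes_inj)
    have "truncate n f = (\<Sum>\<alpha>\<in>K. Poly_Mapping.single \<alpha> (coeff f \<alpha>))"
    proof (rule poly_mapping_eqI)
      fix \<kappa>
      show "Poly_Mapping.lookup (truncate n f) \<kappa> = Poly_Mapping.lookup (\<Sum>\<alpha>\<in>K. Poly_Mapping.single \<alpha> (coeff f \<alpha>)) \<kappa>"
        using fin K[of \<kappa>] by (auto simp: lookup_sum lookup_single when_def lookup_truncate f)
    qed
    \<comment> \<open>Permuting by \<sigma> preserves both \<open>vectors n\<close> and the
      coefficients of f, so it maps K bijectively to itself.\<close>
    also have "\<dots> = (\<Sum>\<alpha>\<in>K. Poly_Mapping.single (Poly_Mapping.map_key \<sigma> \<alpha>) (coeff f \<alpha>))"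
      by (rule sum.reindex_bij_witness[of _ "Poly_Mapping.map_key \<sigma>" "Poly_Mapping.map_key ?\<tau>"])
        (auto simp: K map_key_inv[OF bij] Lambda_symmetric[OF f] bij \<tau> vec \<sigma>)
    finally have "truncate n f = (\<Sum>\<alpha>\<in>K. Poly_Mapping.single (Poly_Mapping.map_key \<sigma> \<alpha>) (coeff f \<alpha>))" .
    then show ?thesis
      by (simp add: sum_distrib_left mult_single map_key_plus[OF inj] mult.commute flip: single_of_int)
  qed
  have "truncate n f * alternant n \<gamma> = (\<Sum>\<sigma> | \<sigma> permutes {..<n}.
      Poly_Mapping.single (Poly_Mapping.map_key \<sigma> \<gamma>) (sign \<sigma>) * truncate n f)"
    by (simp add: alternant_eq[OF \<gamma>] sum_distrib_left mult.commute)
  also have "\<dots> = (\<Sum>\<sigma> | \<sigma> permutes {..<n}.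
      \<Sum>\<alpha>\<in>K. of_int (coeff f \<alpha>) * Poly_Mapping.single (Poly_Mapping.map_key \<sigma> (\<gamma> + \<alpha>)) (sign \<sigma>))"
    by (rule sum.cong) (simp_all add: *)
  also have "\<dots> = (\<Sum>\<alpha>\<in>K. of_int (coeff f \<alpha>) * (\<Sum>\<sigma> | \<sigma> permutes {..<n}.
      Poly_Mapping.single (Poly_Mapping.map_key \<sigma> (\<gamma> + \<alpha>)) (sign \<sigma>)))"
    by (subst sum.swap) (simp add: sum_distrib_left)
  also have "\<dots> = (\<Sum>\<alpha>\<in>K. of_int (coeff f \<alpha>) * alternant n (\<gamma> + \<alpha>))"
    by (rule sum.cong) (simp_all add: alternant_eq add_in_vectors_iff K \<gamma>)
  finally show ?thesis
    by (simp add: K_def)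
qed

subsection \<open>Schur functions\<close>

text \<open>Both alternants are a Jacobi-Trudi determinant times the same D. For \<alpha> = 0 the
  determinant is 1, so D is the alternant of the staircase.\<close>

lemma truncate_jacobi_trudi_mult_alternant:
  "truncate n (jacobi_trudi n complete (Poly_Mapping.lookup \<alpha>)) * alternant n (staircase n)
    = alternant n (staircase n + \<alpha>)"
proof -
  let ?h = "\<lambda>k. truncate n (complete k)"
  have h: "fps_nth (Abs_fps ?h) = ?h"
    by (rule ext) simp
  obtain D where D: "\<And>a. (\<Sum>\<sigma> | \<sigma> permutes {..<n}. of_int (sign \<sigma>) *
      (\<Prod>i<n. X (\<sigma> i) ^ (n - 1 - i + a i))) = jacobi_trudi n ?h a * D"
    using ex_jacobi_trudi_factor[OF complete_mult_prod, of n] unfolding h by blast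
  have alt: "alternant n (staircase n + \<beta>) = jacobi_trudi n ?h (Poly_Mapping.lookup \<beta>) * D" for \<beta>
    unfolding alternant_def by (simp add: lookup_add lookup_staircase flip: D)
  have "Poly_Mapping.lookup (0 :: composition) = (\<lambda>_. 0)"
    by (rule ext) simp
  then have "alternant n (staircase n) = D"
    using alt[of 0] by simp
  with alt[of \<alpha>] show ?thesis
    by (simp add: truncate_jacobi_trudi)
qed

text \<open>The polynomials form an integral domain and the staircase alternant is nonzero, so the
  quotient chosen by \<open>THE\<close> is unique.\<close>

lemma schur_poly_eqI:
  assumes "\<alpha> \<in> vectors n" "q * alternant n (staircase n) = alternant n (staircase n + \<alpha>)"
  shows "schur_poly n \<alpha> = q"
proof -
  have "(THE q. q * alternant n (staircase n) = alternant n (staircase n + \<alpha>)) = q"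
  proof (rule the_equality)
    show "p = q" if "p * alternant n (staircase n) = alternant n (staircase n + \<alpha>)" for p
      using that assms(2) alternant_staircase_nonzero[of n] by (metis mult_right_cancel)
  qed (rule assms(2))
  then show ?thesis
    using assms(1) by (simp add: schur_poly_def)
qed

text \<open>
  A series truncating to \<open>s\<^sub>\<alpha>\<close> in \<open>n + 1\<close> indeterminates vanishes at \<open>X n = 0\<close>, because then
  \<open>X n\<close> divides \<open>a\<^bsub>\<delta>+\<alpha>\<^esub>\<close> but not \<open>a\<^sub>\<delta>\<close>.
\<close>

lemma truncate_eq_0_of_last_positive:
  assumes s: "s \<in> Lambda"
    and eq: "truncate (Suc n) s * alternant (Suc n) (staircase (Suc n))
      = alternant (Suc n) (staircase (Suc n) + \<alpha>)"
    and \<alpha>: "\<alpha> \<in> vectors (Suc n)" "Poly_Mapping.lookup \<alpha> n > 0"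
  shows "truncate n s = 0"
proof -
  have "cut n (truncate (Suc n) s) * cut n (alternant (Suc n) (staircase (Suc n)))
      = cut n (alternant (Suc n) (staircase (Suc n) + \<alpha>))"
    by (simp flip: cut_mult add: eq)
  also have "\<dots> = 0"
  proof (rule cut_alternant_eq_0)
    show "Poly_Mapping.lookup (staircase (Suc n) + \<alpha>) i > 0" if "i \<le> n" for i
      using that \<alpha>(2) by (cases "i = n") (auto simp: lookup_add lookup_staircase)
  qed (simp add: add_in_vectors_iff \<alpha>)
  finally have "cut n (truncate (Suc n) s) = 0"
    using cut_alternant_staircase_nonzero[of n] by simp
  then show ?thesis
    by (simp add: cut_truncate s)
qed

text \<open>For \<alpha> \<noteq> 0 the position n of the last nonzero entry is one less than the
  least m with \<alpha> in \<open>vectors m\<close>.\<close>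

lemma vectors_last_cases:
  obtains "\<alpha> = 0" | n where "\<alpha> \<in> vectors (Suc n)" "\<alpha> \<notin> vectors n" "Poly_Mapping.lookup \<alpha> n > 0"
proof -
  define m where "m = (LEAST m. \<alpha> \<in> vectors m)"
  have m: "\<alpha> \<in> vectors m"
    unfolding m_def using ex_vectors by (rule LeastI_ex)
  have notin: "\<alpha> \<notin> vectors k" if "k < m" for k
    using that not_less_Least unfolding m_def by blast
  show thesis
  proof (cases m)
    case 0
    with m have "\<alpha> = 0"
      by (auto simp: vectors_iff intro!: poly_mapping_eqI)
    then show ?thesis
      by (rule that(1))
  next
    case (Suc n)
    have "Poly_Mapping.lookup \<alpha> n > 0"
    proof (rule ccontr)
      assume "\<not> Poly_Mapping.lookup \<alpha> n > 0"
      then have "Poly_Mapping.lookup \<alpha> i = 0" if "n \<le> i" for i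
        using that m Suc by (cases "i = n") (auto simp: vectors_iff)
      then show False
        using notin[of n] Suc by (simp add: vectors_iff)
    qed
    then show ?thesis
      using m notin[of n] Suc that(2) by auto
  qed
qed

text \<open>The Jacobi-Trudi determinant is independent of its size once the size covers \<alpha>,
  so one element serves all large n. For smaller n \<open>schur_poly\<close> is 0 by definition, and
  the positive last entry of \<alpha> makes the truncation vanish too.\<close>

lemma ex_schur: "\<exists>s\<in>Lambda. \<forall>n. truncate n s = schur_poly n \<alpha>"
proof -
  define J where "J n = jacobi_trudi n complete (Poly_Mapping.lookup \<alpha>)" for n
  have J: "J n \<in> Lambda" for n
    by (simp add: J_def jacobi_trudi_in_Lambda)
  have J_mono: "J n = J m" if "m \<le> n" "\<alpha> \<in> vectors m" for m n
    unfolding J_def by (rule jacobi_trudi_mono) (use that in \<open>auto simp: vectors_iff\<close>)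
  have J_schur: "truncate n (J m) = schur_poly n \<alpha>" if "m \<le> n" "\<alpha> \<in> vectors m" for m n
    using schur_poly_eqI[OF vectors_mono[OF that] truncate_jacobi_trudi_mult_alternant] J_mono[OF that]
    by (simp add: J_def)
  show ?thesis
  proof (cases rule: vectors_last_cases[of \<alpha>])
    case 1
    then have "\<alpha> \<in> vectors 0"
      by (simp add: vectors_iff)
    then show ?thesis
      using J_schur J by blast
  next
    case (2 m)
    have "truncate n (J (Suc m)) = schur_poly n \<alpha>" for n
    proof (cases "Suc m \<le> n")
      \<comment> \<open>The truncation to n \<le> m indeterminates factors through the one to m,
        which is already 0.\<close>
      case False
      have "truncate m (J (Suc m)) = 0"
        by (rule truncate_eq_0_of_last_positive[OF J _ 2(1) 2(3)])
          (simp add: J_def truncate_jacobi_trudi_mult_alternant)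
      moreover have "truncate n (J (Suc m)) = cut n (truncate m (J (Suc m)))"
        using False by (simp add: cut_truncate J)
      moreover have "cut n 0 = 0"
        by (rule poly_mapping_eqI) (simp add: lookup_cut)
      moreover have "\<alpha> \<notin> vectors n"
        using False 2(2) vectors_mono[of n m \<alpha>] by auto
      ultimately show ?thesis
        by (simp add: schur_poly_def)
    qed (use J_schur 2(1) in blast)
    then show ?thesis
      using J by blast
  qed
qed

text \<open>The Jacobi-Trudi element gives existence, and truncations separate the elements of
  \<open>Lambda\<close>; so the \<open>THE\<close> in \<open>schur\<close> has a unique
  witness.\<close>

lemma schur_in_Lambda [simp]: "schur \<alpha> \<in> Lambda"
  and truncate_schur: "truncate n (schur \<alpha>) = schur_poly n \<alpha>"
proof -
  have "\<exists>!s. s \<in> Lambda \<and> (\<forall>n. truncate n s = schur_poly n \<alpha>)"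
    using ex_schur[of \<alpha>] Lambda_eqI by (metis (no_types))
  then have "schur \<alpha> \<in> Lambda \<and> (\<forall>n. truncate n (schur \<alpha>) = schur_poly n \<alpha>)"
    unfolding schur_def by (rule theI')
  then show "schur \<alpha> \<in> Lambda" "truncate n (schur \<alpha>) = schur_poly n \<alpha>"
    by auto
qed

lemma truncate_schur_eq_0: "\<alpha> \<notin> vectors n \<Longrightarrow> truncate n (schur \<alpha>) = 0"
  by (simp add: truncate_schur schur_poly_def)

lemma truncate_schur_mult_alternant:
  assumes "\<alpha> \<in> vectors n"
  shows "truncate n (schur \<alpha>) * alternant n (staircase n) = alternant n (staircase n + \<alpha>)"
  using schur_poly_eqI[OF assms truncate_jacobi_trudi_mult_alternant]
    truncate_jacobi_trudi_mult_alternant[of n \<alpha>]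
  by (simp add: truncate_schur)

section \<open>Vanishing of Schur functions whose index is too long for its weight\<close>

lemma sum_upto_card_le_sum:
  fixes S :: "nat set"
  assumes "finite S" "0 \<notin> S"
  shows "\<Sum>{1..card S} \<le> \<Sum>S"
  using assms
proof (induction S rule: finite_linorder_max_induct)
  case (insert b A)
  \<comment> \<open>All elements other than the maximum b lie between 1 and b - 1, so b is at least
    the new cardinality.\<close>
  have "A \<subseteq> {1..<b}"
    using insert by (auto simp: Suc_le_eq) (metis gr0I)
  then have "card A \<le> b - 1"
    using card_mono[of "{1..<b}" A] by simp
  moreover have "b \<noteq> 0" "b \<notin> A"
    using insert by auto
  ultimately show ?case
    using insert by simp
qed simp

text \<open>
  If \<open>\<gamma>\<close> has last nonzero entry \<open>\<gamma> n\<close> with \<open>n \<ge> weight \<gamma>\<close>, then the \<open>n + 1\<close> entries of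
  \<open>\<delta> + \<gamma>\<close> are positive with sum less than \<open>1 + \<dots> + (n + 1)\<close>, so two of them agree.
\<close>

lemma schur_eq_0:
  assumes "\<gamma> \<notin> vectors (weight \<gamma>)"
  shows "schur \<gamma> = 0"
proof (cases rule: vectors_last_cases[of \<gamma>])
  case 1
  with assms show ?thesis
    by (simp add: vectors_iff)
next
  case (2 n)
  \<comment> \<open>These are the entries of \<open>staircase (Suc n) + \<gamma>\<close> at the
    positions up to n.\<close>
  let ?g = "\<lambda>i. n - i + Poly_Mapping.lookup \<gamma> i"
  have n: "weight \<gamma> \<le> n"
    using assms 2(1) vectors_mono[of "Suc n" "weight \<gamma>" \<gamma>] by linarith
  have w: "weight \<gamma> = (\<Sum>i<Suc n. Poly_Mapping.lookup \<gamma> i)"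
    by (rule weight_eq_sum) (use 2(1) in \<open>auto simp: vectors_def\<close>)
  have "\<not> inj_on ?g {..<Suc n}"
  proof
    assume inj: "inj_on ?g {..<Suc n}"
    have "\<Sum>{1..card (?g ` {..<Suc n})} \<le> \<Sum>(?g ` {..<Suc n})"
      using 2(3) by (intro sum_upto_card_le_sum) (auto simp: less_Suc_eq)
    also have "\<dots> = (\<Sum>i<Suc n. n - i) + weight \<gamma>"
      by (simp only: sum.reindex[OF inj] comp_def sum.distrib w)
    also have "(\<Sum>i<Suc n. n - i) = (\<Sum>i<Suc n. i)"
      using sum.nat_diff_reindex[of "\<lambda>i. i" "Suc n"] by (simp del: sum.lessThan_Suc)
    also have "card (?g ` {..<Suc n}) = Suc n"
      by (simp only: card_image[OF inj] card_lessThan)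
    also have "\<Sum>{1..Suc n} = (\<Sum>i<Suc n. i) + Suc n"
      by (induction n) simp_all
    \<comment> \<open>The comparison leaves n + 1 \<le> \<open>weight \<gamma>\<close>, against
      \<open>weight \<gamma> \<le> n\<close>.\<close>
    finally show False
      using n by simp
  qed
  then obtain i j where ij: "i \<le> n" "j \<le> n" "i \<noteq> j" "?g i = ?g j"
    by (auto simp: inj_on_def less_Suc_eq_le)
  have "truncate N (schur \<gamma>) = 0" for N
  proof (cases "\<gamma> \<in> vectors N")
    case True
    then have "n < N"
      using 2(2) vectors_mono[of N n \<gamma>] by (meson not_less)
    \<comment> \<open>Passing from n + 1 to N indeterminates adds N - 1 - n to both entries, so they
      still agree.\<close>
    then have "alternant N (staircase N + \<gamma>) = 0"
      using ij by (intro alternant_eq_0[of i N j]) (auto simp: lookup_add lookup_staircase)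
    then show ?thesis
      using truncate_schur_mult_alternant[OF True] alternant_staircase_nonzero[of N] by simp
  qed (rule truncate_schur_eq_0)
  then show ?thesis
    by (intro Lambda_eqI) simp_all
qed

text \<open>\<open>Sum_any\<close> takes the default value 0 on an infinite support, so finiteness
  is asserted alongside the equation.\<close>

theorem lemma2p2:
  fixes f :: pseries
  assumes "f \<in> Lambda"
  shows "\<forall>\<beta>. finite {\<alpha>. of_int (coeff f \<alpha>) * schur (\<alpha> + \<beta>) \<noteq> 0} \<and>
             f * schur \<beta> = Sum_any (\<lambda>\<alpha>. of_int (coeff f \<alpha>) * schur (\<alpha> + \<beta>))"
proof
  fix \<beta>
  let ?t = "\<lambda>\<alpha>. of_int (coeff f \<alpha>) * schur (\<alpha> + \<beta>)"
  obtain d where d: "\<And>\<alpha>. coeff f \<alpha> \<noteq> 0 \<Longrightarrow> weight \<alpha> \<le> d"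
    using Lambda_bounded[OF assms] by blast
  \<comment> \<open>A nonzero term needs \<open>weight \<alpha> \<le> d\<close>, and by
    \<open>schur_eq_0\<close> then \<alpha> + \<beta> lies in
    \<open>vectors (d + weight \<beta>)\<close>. This finite set works for every number of
    indeterminates at once.\<close>
  define F where "F = {\<alpha>. \<alpha> \<in> vectors (d + weight \<beta>) \<and> weight \<alpha> \<le> d}"
  have "F \<subseteq> {\<alpha>. Poly_Mapping.keys \<alpha> \<subseteq> {..<d + weight \<beta>} \<and> (\<forall>i. Poly_Mapping.lookup \<alpha> i \<le> d)}"
    using lookup_le_weight le_trans by (fastforce simp: F_def vectors_def)
  then have F: "finite F"
    by (rule finite_subset) (rule finite_bounded_compositions, simp)
  have supp: "{\<alpha>. ?t \<alpha> \<noteq> 0} \<subseteq> F"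
  proof
    fix \<alpha> assume "\<alpha> \<in> {\<alpha>. ?t \<alpha> \<noteq> 0}"
    then have "coeff f \<alpha> \<noteq> 0" "schur (\<alpha> + \<beta>) \<noteq> 0"
      by auto
    then have \<alpha>: "weight \<alpha> \<le> d" and "\<alpha> + \<beta> \<in> vectors (weight \<alpha> + weight \<beta>)"
      using d schur_eq_0[of "\<alpha> + \<beta>"] by (auto simp: weight_add)
    then have "\<alpha> + \<beta> \<in> vectors (d + weight \<beta>)"
      by (elim vectors_mono[rotated]) simp
    with \<alpha> show "\<alpha> \<in> F"
      by (simp add: F_def add_in_vectors_iff)
  qed
  have "f * schur \<beta> = (\<Sum>\<alpha>\<in>F. ?t \<alpha>)"
  proof (rule Lambda_eqI)
    show "f * schur \<beta> \<in> Lambda" "(\<Sum>\<alpha>\<in>F. ?t \<alpha>) \<in> Lambda"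
      using assms by (auto intro!: Lambda_mult Lambda_sum)
    fix n
    have lhs: "truncate n (f * schur \<beta>) = truncate n f * truncate n (schur \<beta>)"
      using assms by (simp add: truncate_mult)
    have T: "truncate n (?t \<alpha>) = of_int (coeff f \<alpha>) * truncate n (schur (\<alpha> + \<beta>))" for \<alpha>
      by (simp add: truncate_mult)
    have rhs: "truncate n (\<Sum>\<alpha>\<in>F. ?t \<alpha>) = (\<Sum>\<alpha>\<in>F. truncate n (?t \<alpha>))"
      by (rule truncate_sum) (simp add: Lambda_mult)
    show "truncate n (f * schur \<beta>) = truncate n (\<Sum>\<alpha>\<in>F. ?t \<alpha>)"
    proof (cases "\<beta> \<in> vectors n")
      \<comment> \<open>If \<beta> lies outside \<open>vectors n\<close>, so does every \<alpha> +
        \<beta>, and both sides truncate to 0.\<close>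
      case False
      then show ?thesis
        unfolding lhs rhs T by (simp add: truncate_schur_eq_0 add_in_vectors_iff)
    next
      case True
      let ?a = "alternant n (staircase n)"
      have "truncate n (f * schur \<beta>) * ?a = truncate n f * alternant n (staircase n + \<beta>)"
        by (simp add: lhs mult.assoc truncate_schur_mult_alternant[OF True])
      also have "\<dots> = (\<Sum>\<alpha>\<in>Poly_Mapping.keys (truncate n f).
          of_int (coeff f \<alpha>) * alternant n (staircase n + \<beta> + \<alpha>))"
        by (rule symmetric_times_alternant) (simp_all add: assms add_in_vectors_iff True)
      \<comment> \<open>The monomials of the truncated f and the fixed set F may differ; the terms
        outside their intersection vanish on either side.\<close>
      also have "\<dots> = (\<Sum>\<alpha>\<in>F. truncate n (?t \<alpha>) * ?a)"
      proof (rule sum.mono_neutral_cong)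
        have eq: "of_int (coeff f \<alpha>) * alternant n (staircase n + \<beta> + \<alpha>) = truncate n (?t \<alpha>) * ?a"
          if "\<alpha> \<in> vectors n" for \<alpha>
        proof -
          have "truncate n (?t \<alpha>) * ?a = of_int (coeff f \<alpha>) * (truncate n (schur (\<alpha> + \<beta>)) * ?a)"
            by (simp only: T mult.assoc)
          also have "\<dots> = of_int (coeff f \<alpha>) * alternant n (staircase n + (\<alpha> + \<beta>))"
            by (subst truncate_schur_mult_alternant) (simp_all add: add_in_vectors_iff that True)
          finally show ?thesis
            by (simp only: add.assoc add.commute[of \<beta> \<alpha>])
        qed
        show "of_int (coeff f \<alpha>) * alternant n (staircase n + \<beta> + \<alpha>) = truncate n (?t \<alpha>) * ?a"
          if "\<alpha> \<in> Poly_Mapping.keys (truncate n f) \<inter> F" for \<alpha>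
          using that by (intro eq) (auto simp: in_keys_iff lookup_truncate assms split: if_splits)
        \<comment> \<open>Outside F the term is 0 already in \<open>Lambda\<close>; truncating it
          and multiplying by the staircase alternant carries this over to the alternants.\<close>
        show "of_int (coeff f \<alpha>) * alternant n (staircase n + \<beta> + \<alpha>) = 0"
          if \<alpha>: "\<alpha> \<in> Poly_Mapping.keys (truncate n f) - F" for \<alpha>
        proof -
          have "?t \<alpha> = 0"
            using \<alpha> supp by auto
          moreover have "\<alpha> \<in> vectors n"
            using \<alpha> by (auto simp: in_keys_iff lookup_truncate assms split: if_splits)
          ultimately show ?thesis
            by (simp add: eq)
        qed
        \<comment> \<open>Either the coefficient of f is 0, or \<alpha> is outside
          \<open>vectors n\<close> and the Schur function of \<alpha> + \<beta> truncates to
          0.\<close>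
        show "truncate n (?t \<alpha>) * ?a = 0" if "\<alpha> \<in> F - Poly_Mapping.keys (truncate n f)" for \<alpha>
          using that unfolding T
          by (auto simp: in_keys_iff lookup_truncate assms truncate_schur_eq_0 add_in_vectors_iff
              split: if_splits)
      qed (simp_all add: F)
      finally have "truncate n (f * schur \<beta>) * ?a = truncate n (\<Sum>\<alpha>\<in>F. ?t \<alpha>) * ?a"
        by (simp only: rhs sum_distrib_right)
      then show ?thesis
        by (rule mult_right_cancel[OF alternant_staircase_nonzero, THEN iffD1])
    qed
  qed
  also have "\<dots> = Sum_any ?t"
    by (rule Sum_any.expand_superset[symmetric, OF F supp])
  finally show "finite {\<alpha>. ?t \<alpha> \<noteq> 0} \<and> f * schur \<beta> = Sum_any ?t"
    using finite_subset[OF supp F] by simp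
qed

end
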